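(* Let $\mathcal{Z}\subseteq\mathbb{R}^n$ be a closed convex set and $F:\mathcal{Z}\to\mathbb{R}^n$ a monotone operator. For any $z\in\mathcal{Z}$, $r^{tan}_{(F,\mathcal{Z})}(z)\ge r^{nat}_{(F,\mathcal{Z})}(z)$.
   Context: $\|\cdot\|$ is the Euclidean norm and $\langle\cdot,\cdot\rangle$ the Euclidean inner product; $\Pi_C$ denotes Euclidean projection onto a closed convex set $C$. $F$ is monotone if $\langle F(z)-F(z'),z-z'\rangle\ge0$ for all $z,z'\in\mathcal{Z}$. Natural residual: $r^{nat}_{(F,\mathcal{Z})}(z)=\|z-\Pi_{\mathcal{Z}}(z-F(z))\|$. Tangent residual: let $N_{\mathcal{Z}}(z)=\{v\in\mathbb{R}^n:\langle v,z'-z\rangle\le0\ \forall z'\in\mathcal{Z}\}$ be the normal cone, $T_{\mathcal{Z}}(z)=\{z'\in\mathbb{R}^n:\langle z',a\rangle\le0\ \forall a\in N_{\mathcal{Z}}(z)\}$ the tangent cone, and $J_{\mathcal{Z}}(z)=\{z\}+T_{\mathcal{Z}}(z)$. Then $r^{tan}_{(F,\mathcal{Z})}(z)=\|\Pi_{J_{\mathcal{Z}}(z)}[z-F(z)]-z\|$. *)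

theory Defs
  imports "HOL-Analysis.Analysis"
begin

text \<open>
  An operator on a set \<open>Z\<close> is a total function of which only the values on \<open>Z\<close> matter.
  The Euclidean projection onto a closed convex set is \<^const>\<open>closest_point\<close>.
\<close>

definition monotone_operator_on :: "(real^'n) set \<Rightarrow> (real^'n \<Rightarrow> real^'n) \<Rightarrow> bool" where
  "monotone_operator_on Z F \<longleftrightarrow> (\<forall>z\<in>Z. \<forall>z'\<in>Z. (F z - F z') \<bullet> (z - z') \<ge> 0)"

definition natural_residual :: "(real^'n \<Rightarrow> real^'n) \<Rightarrow> (real^'n) set \<Rightarrow> real^'n \<Rightarrow> real" where
  "natural_residual F Z z = norm (z - closest_point Z (z - F z))"

definition normal_cone :: "(real^'n) set \<Rightarrow> real^'n \<Rightarrow> (real^'n) set" where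
  "normal_cone Z z = {v. \<forall>z'\<in>Z. v \<bullet> (z' - z) \<le> 0}"

definition tangent_cone :: "(real^'n) set \<Rightarrow> real^'n \<Rightarrow> (real^'n) set" where
  "tangent_cone Z z = {z'. \<forall>a\<in>normal_cone Z z. z' \<bullet> a \<le> 0}"

definition translated_tangent_cone :: "(real^'n) set \<Rightarrow> real^'n \<Rightarrow> (real^'n) set" where
  "translated_tangent_cone Z z = {z + t | t. t \<in> tangent_cone Z z}"

definition tangent_residual :: "(real^'n \<Rightarrow> real^'n) \<Rightarrow> (real^'n) set \<Rightarrow> real^'n \<Rightarrow> real" where
  "tangent_residual F Z z = norm (closest_point (translated_tangent_cone Z z) (z - F z) - z)"

end

theory Submission
  imports Defs
begin

text \<open>
  Put \<open>u = - F z\<close>. The tangent residual is \<open>norm b\<close> and the natural residual is \<open>norm a\<close>, where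
  \<open>b\<close> is the projection of \<open>u\<close> onto the tangent cone \<open>T\<close> and \<open>z + a\<close> is the projection of \<open>z + u\<close>
  onto \<open>Z\<close>. Testing the variational inequality of the second projection at the point \<open>z\<close> of \<open>Z\<close>
  gives \<open>a \<bullet> a \<le> u \<bullet> a\<close>. Since \<open>a\<close> lies in \<open>T\<close> and \<open>T\<close> is closed under addition, the
  variational inequality of the first projection may be tested at \<open>b + a\<close>, which gives
  \<open>(u - b) \<bullet> a \<le> 0\<close>. Together \<open>a \<bullet> a \<le> b \<bullet> a\<close>, and the Cauchy--Schwarz inequality concludes.
\<close>

lemma diff_mem_tangent_cone:
  assumes "y \<in> Z"
  shows "y - z \<in> tangent_cone Z z"
  using assms by (auto simp: tangent_cone_def normal_cone_def inner_commute)

lemma tangent_cone_add: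
  assumes "s \<in> tangent_cone Z z" and "t \<in> tangent_cone Z z"
  shows "s + t \<in> tangent_cone Z z"
  using assms by (fastforce simp: tangent_cone_def inner_add_left)

lemma mem_translated_tangent_cone_iff:
  "y \<in> translated_tangent_cone Z z \<longleftrightarrow> y - z \<in> tangent_cone Z z"
  by (force simp: translated_tangent_cone_def)

lemma translated_tangent_cone_eq_INT_halfspaces:
  "translated_tangent_cone Z z = (\<Inter>a\<in>normal_cone Z z. {y. a \<bullet> y \<le> a \<bullet> z})"
  by (auto simp: mem_translated_tangent_cone_iff tangent_cone_def inner_diff_left inner_diff_right
      inner_commute)

lemma closed_translated_tangent_cone: "closed (translated_tangent_cone Z z)"
  unfolding translated_tangent_cone_eq_INT_halfspaces
  by (intro closed_INT ballI closed_halfspace_le)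

lemma convex_translated_tangent_cone: "convex (translated_tangent_cone Z z)"
  unfolding translated_tangent_cone_eq_INT_halfspaces
  by (intro convex_INT convex_halfspace_le)

theorem lemma1:
  fixes Z :: "(real^'n) set" and F :: "real^'n \<Rightarrow> real^'n" and z :: "real^'n"
  assumes "closed Z" and "convex Z"
    and "monotone_operator_on Z F"
    and "z \<in> Z"
  shows "tangent_residual F Z z \<ge> natural_residual F Z z"
proof -
  let ?J = "translated_tangent_cone Z z"
  define x where "x = z - F z"
  define a where "a = closest_point Z x - z"
  define b where "b = closest_point ?J x - z"
  have "Z \<noteq> {}" using \<open>z \<in> Z\<close> by blast
  then have a_tangent: "a \<in> tangent_cone Z z"
    unfolding a_def using \<open>closed Z\<close> by (intro diff_mem_tangent_cone closest_point_in_set)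
  have "z \<in> ?J"
    using diff_mem_tangent_cone[OF \<open>z \<in> Z\<close>, of z] by (simp add: mem_translated_tangent_cone_iff)
  then have "closest_point ?J x \<in> ?J"
    by (intro closest_point_in_set closed_translated_tangent_cone) blast
  then have "b \<in> tangent_cone Z z"
    by (simp add: b_def mem_translated_tangent_cone_iff)
  then have "z + (b + a) \<in> ?J"
    using a_tangent by (simp add: mem_translated_tangent_cone_iff tangent_cone_add)
  from closest_point_dot[OF convex_translated_tangent_cone closed_translated_tangent_cone this, of x]
  have "(x - z - b) \<bullet> a \<le> 0"
    by (simp add: b_def)
  moreover have "(x - z - a) \<bullet> (- a) \<le> 0"
    using closest_point_dot[OF \<open>convex Z\<close> \<open>closed Z\<close> \<open>z \<in> Z\<close>, of x] by (simp add: a_def)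
  ultimately have "a \<bullet> a \<le> b \<bullet> a"
    by (simp add: inner_diff_left)
  also have "\<dots> \<le> norm b * norm a"
    by (rule norm_cauchy_schwarz)
  finally have "norm a * norm a \<le> norm b * norm a"
    by (simp add: dot_square_norm power2_eq_square)
  then have "norm a \<le> norm b"
    by (cases "a = 0") auto
  then show ?thesis
    by (simp add: tangent_residual_def natural_residual_def a_def b_def x_def norm_minus_commute)
qed

end
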